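(* In the duopoly model described in the context, horizontal XAI fairness cannot be guaranteed for all $\beta t$, whatever level the policy-maker chooses (in particular even if it does not seek to maximize total welfare): for each of the two horizontal differentiations of the firms ('max' and 'min') there exist $\beta,t>0$ such that for no $\xi\in[0,1]$ does the resulting market have an equilibrium that is horizontally fair, neither under mandatory XAI nor under optional XAI.
   Context: Model. Two firms $i=1,2$; parameters $\beta>0$ (quality cost) and $t>0$ (misfit cost). Customers $(x,\theta)$ are uniformly distributed on $[0,1]^2$. A customer buying from firm $i$ with quality $q_i\ge 0$, price $p_i\ge0$, XAI level $\xi_i\in[0,1]$ and location (XAI method) $e_i$ has utility $u_i=V+\theta q_i-p_i-t(1-\xi_i)|x-e_i|$, where the reservation value $V$ is large enough that every customer's utility is positive in equilibrium and every customer makes exactly one purchase, from the firm giving the higher utility. The term $-t(1-\xi_i)|x-e_i|$ is the XAI (dis)utility. Firm 1 is the high-quality firm ($q_1\ge q_2$). Locations are exogenous: 'max' means $e_1=0,e_2=1$; 'min' means $e_1=e_2=1/2$. The demand $d_i$ is the area of the set of customers buying from $i$; profit is $\pi_i=p_id_i-\beta q_i^2$. A market is quality-dominated (Q) if for every $x\in[0,1]$ there is an indifferent customer, and explanation-dominated (E) if for every $\theta\in[0,1]$ there is an indifferent customer. Under optional XAI the policy-maker chooses $\xi\in[0,1]$ and each firm chooses $\xi_i\in\{0,\xi\}$, then qualities, then prices. Under mandatory XAI the policy-maker chooses $\xi$ and $\xi_1=\xi_2=\xi$ is imposed; firms then choose qualities, then prices. The possible equilibria are: (Q2; 'max' or 'min';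 optional and mandatory) $\xi_1=\xi_2=\xi$, possible iff $\beta t\,\xi<4/9$: $\pi_1=\frac{4}{81\beta}$, $\pi_2=\frac{2}{81\beta}$. (E2; 'max'; mandatory only) $\xi_1=\xi_2=\xi$, possible iff $\beta t>\frac{1}{6(2\xi^2-7\xi+6)}$: $\pi_1=\pi_2=\frac{t(1-\xi)}2-\frac1{144\beta}$. (E0; 'max'; optional only) $\xi_1=\xi_2=0$, possible iff $\beta t>\frac{1}{6(2\xi^2-7\xi+6)}$ and $\xi\le 1-\frac1{36\beta t}$: $\pi_1=\pi_2=\frac t2-\frac1{144\beta}$. (E1; 'max'; optional only) $\xi_1=\xi,\ \xi_2=0$, possible iff $\beta t>\frac{1}{6(2\xi^2-7\xi+6)}$ and $\xi>1-\frac1{36\beta t}$: with $a=\beta t$, $N_1=36a-12a\xi-1$, $N_2=36a-24a\xi-1$, $D=36a-18a\xi-1$, $M=72a-36a\xi-1$, $\pi_i=\frac{N_i^2M}{144\beta D^2}$. (E1; 'min'; optional only) $\xi_1=\xi,\ \xi_2=0$, possible iff $\beta t\,\xi>2/9$: with $\psi=\beta t\xi$, $\pi_1=\frac{(18\psi-1)(12\psi-1)^2}{144\beta(9\psi-1)^2}$, $\pi_2=\frac{(18\psi-1)(6\psi-1)^2}{144\beta(9\psi-1)^2}$. Market selection. If only one market (E or Q) is possible, it forms. If both are possible, each firm prefers the one giving it the higher profit; if the firms agree, that market forms, and if they disagree there is no Nash equilibrium. Under mandatory XAI, if profits in the resulting market are negative (or no market is possible) the firms leave and there is no market equilibrium.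 Horizontal fairness. An equilibrium is horizontally fair if all customers on the Hotelling line (all $x\in[0,1]$) receive the same XAI (dis)utility; in the paper this is the requirement that firms offer full explanations, $\xi_1=\xi_2=1$. *)

theory Defs
  imports "HOL-Analysis.Analysis"
begin

datatype firm = Firm1 | Firm2

datatype differentiation = MaxDiff | MinDiff

datatype regime = Mandatory | Optional

datatype market = QualityDominated | ExplanationDominated

fun location :: "differentiation \<Rightarrow> firm \<Rightarrow> real" where
  "location MaxDiff Firm1 = 0"
| "location MaxDiff Firm2 = 1"
| "location MinDiff i = 1 / 2"

text \<open>A customer is a pair \<open>(x, \<theta>)\<close> of a Hotelling position and a taste for quality.\<close>

definition customers :: "(real \<times> real) set" where
  "customers = {0..1} \<times> {0..1}"

record outcome =
  xai :: "firm \<Rightarrow> real"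
  quality :: "firm \<Rightarrow> real"
  price :: "firm \<Rightarrow> real"
  buys :: "real \<times> real \<Rightarrow> firm"

definition xai_utility :: "differentiation \<Rightarrow> real \<Rightarrow> outcome \<Rightarrow> firm \<Rightarrow> real \<Rightarrow> real" where
  "xai_utility d t s i x = - t * (1 - xai s i) * \<bar>x - location d i\<bar>"

definition utility ::
  "differentiation \<Rightarrow> real \<Rightarrow> real \<Rightarrow> outcome \<Rightarrow> firm \<Rightarrow> real \<times> real \<Rightarrow> real" where
  "utility d V t s i = (\<lambda>(x, \<theta>). V + \<theta> * quality s i - price s i + xai_utility d t s i x)"

definition buyers :: "outcome \<Rightarrow> firm \<Rightarrow> (real \<times> real) set" where
  "buyers s i = {c \<in> customers. buys s c = i}"

definition demand :: "outcome \<Rightarrow> firm \<Rightarrow> real" where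
  "demand s i = measure lebesgue (buyers s i)"

definition profit :: "real \<Rightarrow> outcome \<Rightarrow> firm \<Rightarrow> real" where
  "profit \<beta> s i = price s i * demand s i - \<beta> * (quality s i)\<^sup>2"

text \<open>
  Feasible play: every customer buys exactly once, from a firm giving the higher utility, and
  that utility is positive. The map \<open>buys\<close> is part of the outcome so that indifferent customers,
  who may have positive area, are assigned to one of the two firms.
\<close>

definition feasible :: "differentiation \<Rightarrow> real \<Rightarrow> real \<Rightarrow> outcome \<Rightarrow> bool" where
  "feasible d V t s \<longleftrightarrow>
     (\<forall>i. xai s i \<in> {0..1} \<and> quality s i \<ge> 0 \<and> price s i \<ge> 0 \<and> buyers s i \<in> sets lebesgue) \<and>
     quality s Firm1 \<ge> quality s Firm2 \<and>
     (\<forall>c\<in>customers. utility d V t s (buys s c) c > 0 \<and>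
        (\<forall>j. utility d V t s (buys s c) c \<ge> utility d V t s j c))"

fun per_firm :: "real \<Rightarrow> real \<Rightarrow> firm \<Rightarrow> real" where
  "per_firm a b Firm1 = a"
| "per_firm a b Firm2 = b"

text \<open>
  \<open>possible d r \<beta> t \<xi> m X P\<close>: for policy level \<open>\<xi>\<close> under regime \<open>r\<close>, the market \<open>m\<close> has a
  candidate equilibrium with XAI levels \<open>X\<close> and profits \<open>P\<close>. The clauses are the model's
  solutions of the XAI, quality and price stages, with their existence conditions; the conditions
  are taken over as they are, not derived from best responses. In each market there is at most
  one candidate.
\<close>

inductive possible ::
  "differentiation \<Rightarrow> regime \<Rightarrow> real \<Rightarrow> real \<Rightarrow> real \<Rightarrow> market \<Rightarrow> (firm \<Rightarrow> real) \<Rightarrow> (firm \<Rightarrow> real) \<Rightarrow> bool"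
where
  Q2: "\<beta> * t * \<xi> < 4 / 9 \<Longrightarrow>
    possible d r \<beta> t \<xi> QualityDominated (per_firm \<xi> \<xi>)
      (per_firm (4 / (81 * \<beta>)) (2 / (81 * \<beta>)))"
| E2: "\<beta> * t > 1 / (6 * (2 * \<xi>\<^sup>2 - 7 * \<xi> + 6)) \<Longrightarrow>
    possible MaxDiff Mandatory \<beta> t \<xi> ExplanationDominated (per_firm \<xi> \<xi>)
      (per_firm (t * (1 - \<xi>) / 2 - 1 / (144 * \<beta>)) (t * (1 - \<xi>) / 2 - 1 / (144 * \<beta>)))"
| E0: "\<beta> * t > 1 / (6 * (2 * \<xi>\<^sup>2 - 7 * \<xi> + 6)) \<Longrightarrow> \<xi> \<le> 1 - 1 / (36 * \<beta> * t) \<Longrightarrow>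
    possible MaxDiff Optional \<beta> t \<xi> ExplanationDominated (per_firm 0 0)
      (per_firm (t / 2 - 1 / (144 * \<beta>)) (t / 2 - 1 / (144 * \<beta>)))"
| E1_max: "\<beta> * t > 1 / (6 * (2 * \<xi>\<^sup>2 - 7 * \<xi> + 6)) \<Longrightarrow> \<xi> > 1 - 1 / (36 * \<beta> * t) \<Longrightarrow>
    a = \<beta> * t \<Longrightarrow>
    N1 = 36 * a - 12 * a * \<xi> - 1 \<Longrightarrow> N2 = 36 * a - 24 * a * \<xi> - 1 \<Longrightarrow>
    D = 36 * a - 18 * a * \<xi> - 1 \<Longrightarrow> M = 72 * a - 36 * a * \<xi> - 1 \<Longrightarrow>
    possible MaxDiff Optional \<beta> t \<xi> ExplanationDominated (per_firm \<xi> 0)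
      (per_firm (N1\<^sup>2 * M / (144 * \<beta> * D\<^sup>2)) (N2\<^sup>2 * M / (144 * \<beta> * D\<^sup>2)))"
| E1_min: "\<beta> * t * \<xi> > 2 / 9 \<Longrightarrow> \<psi> = \<beta> * t * \<xi> \<Longrightarrow>
    possible MinDiff Optional \<beta> t \<xi> ExplanationDominated (per_firm \<xi> 0)
      (per_firm ((18 * \<psi> - 1) * (12 * \<psi> - 1)\<^sup>2 / (144 * \<beta> * (9 * \<psi> - 1)\<^sup>2))
                ((18 * \<psi> - 1) * (6 * \<psi> - 1)\<^sup>2 / (144 * \<beta> * (9 * \<psi> - 1)\<^sup>2)))"

text \<open>
  A possible market forms if no firm would earn strictly more in the other possible market.
  Under mandatory XAI the firms moreover leave if a profit in that market is negative.
\<close>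

definition selected ::
  "differentiation \<Rightarrow> regime \<Rightarrow> real \<Rightarrow> real \<Rightarrow> real \<Rightarrow> market \<Rightarrow> (firm \<Rightarrow> real) \<Rightarrow> (firm \<Rightarrow> real) \<Rightarrow> bool"
where
  "selected d r \<beta> t \<xi> m X P \<longleftrightarrow>
     possible d r \<beta> t \<xi> m X P \<and>
     (\<forall>m' X' P'. m' \<noteq> m \<and> possible d r \<beta> t \<xi> m' X' P' \<longrightarrow> (\<forall>i. P i \<ge> P' i))"

definition market_equilibrium ::
  "differentiation \<Rightarrow> regime \<Rightarrow> real \<Rightarrow> real \<Rightarrow> real \<Rightarrow> market \<Rightarrow> (firm \<Rightarrow> real) \<Rightarrow> (firm \<Rightarrow> real) \<Rightarrow> bool"
where
  "market_equilibrium d r \<beta> t \<xi> m X P \<longleftrightarrow>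
     selected d r \<beta> t \<xi> m X P \<and> (r = Mandatory \<longrightarrow> (\<forall>i. P i \<ge> 0))"

text \<open>
  Qualities and prices enter only through feasibility and through the profits they must generate;
  the domination pattern named by \<open>m\<close> is not required of them again. Hence every outcome of
  the model with the stated XAI levels and profits counts as an equilibrium here.
\<close>

definition equilibrium ::
  "differentiation \<Rightarrow> regime \<Rightarrow> real \<Rightarrow> real \<Rightarrow> real \<Rightarrow> real \<Rightarrow> outcome \<Rightarrow> bool" where
  "equilibrium d r V \<beta> t \<xi> s \<longleftrightarrow>
     feasible d V t s \<and>
     (\<exists>m P. market_equilibrium d r \<beta> t \<xi> m (xai s) P \<and> (\<forall>i. profit \<beta> s i = P i))"

definition horizontally_fair :: "differentiation \<Rightarrow> real \<Rightarrow> outcome \<Rightarrow> bool" where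
  "horizontally_fair d t s \<longleftrightarrow>
     (\<exists>k. \<forall>x \<theta>. (x, \<theta>) \<in> customers \<longrightarrow> xai_utility d t s (buys s (x, \<theta>)) x = k)"

text \<open>As soon as both firms sell, fairness means full explanations.\<close>

lemma horizontally_fair_if_full: "(\<And>i. xai s i = 1) \<Longrightarrow> horizontally_fair d t s"
  by (auto simp: horizontally_fair_def xai_utility_def)

lemma fair_demand_pos_imp_full:
  assumes fair: "horizontally_fair d t s" and t: "t > 0" and pos: "demand s i > 0"
  shows "xai s i = 1"
proof (rule ccontr)
  assume ne: "xai s i \<noteq> 1"
  obtain k where k: "\<And>x \<theta>. (x, \<theta>) \<in> customers \<Longrightarrow> xai_utility d t s (buys s (x, \<theta>)) x = k"
    using fair by (auto simp: horizontally_fair_def)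
  define h where "h = k / (- t * (1 - xai s i))"
  have "\<bar>x - location d i\<bar> = h" if "(x, \<theta>) \<in> buyers s i" for x \<theta>
  proof -
    have "- t * (1 - xai s i) * \<bar>x - location d i\<bar> = k"
      using that k[of x \<theta>] by (auto simp: buyers_def xai_utility_def)
    then show ?thesis
      using ne t by (auto simp: h_def field_simps)
  qed
  then have sub: "buyers s i \<subseteq> {location d i - h, location d i + h} \<times> UNIV"
    by (fastforce simp: abs_if split: if_splits)
  have "negligible ({v} \<times> (UNIV :: real set))" for v :: real
  proof -
    have "{v} \<times> (UNIV :: real set) = {z. z \<bullet> (1, 0) = v}"
      by (auto simp: inner_prod_def)
    moreover have "negligible {z :: real \<times> real. z \<bullet> (1, 0) = v}"
      by (rule negligible_standard_hyperplane) (auto simp: Basis_prod_def)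
    ultimately show ?thesis by simp
  qed
  then have "negligible ({location d i - h} \<times> (UNIV :: real set) \<union> {location d i + h} \<times> UNIV)"
    by (intro negligible_Un)
  then have "negligible (buyers s i)"
    by (rule negligible_subset) (use sub in auto)
  then have "demand s i = 0"
    by (simp add: demand_def negligible_imp_measure0)
  with pos show False by simp
qed

end

theory Submission
  imports Defs
begin

text \<open>
  Take \<open>\<beta> = t = 1\<close>. Some firm sells to a set of positive area, and fairness forces such a firm to
  offer \<open>\<xi>\<^sub>i = 1\<close>; so the policy level is \<open>\<xi> = 1\<close>. There the quality-dominated
  market is impossible, mandatory XAI in the explanation-dominated market yields negative profits,
  and under optional XAI the firm that offers no explanations earns a positive profit, so it also
  sells to a set of positive area.
\<close>

lemma customers_eq_cbox: "customers = cbox (0, 0) (1, 1)"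
  by (simp add: customers_def cbox_Pair_eq)

lemma measure_customers: "measure lebesgue customers = 1"
proof -
  \<comment> \<open>The area is a box content for \<open>lborel\<close>; the completion
    \<open>lebesgue\<close> agrees with it on Borel sets.\<close>
  have "measure lborel (cbox (0, 0) (1, 1) :: (real \<times> real) set) = 1"
    unfolding content_Pair by simp
  then show ?thesis
    by (simp add: customers_eq_cbox measure_completion)
qed

lemma feasible_total_demand:
  assumes "feasible d V t s"
  shows "demand s Firm1 + demand s Firm2 = 1"
proof -
  have split: "customers = buyers s Firm1 \<union> buyers s Firm2"
    using firm.exhaust by (auto simp: buyers_def)
  have "customers \<in> lmeasurable"
    unfolding customers_eq_cbox by (rule lmeasurable_cbox)
  \<comment> \<open>Additivity of the area needs finite measure, inherited from the square.\<close>
  then have "buyers s i \<in> lmeasurable" for i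
    using assms
    by (auto simp: feasible_def buyers_def intro: fmeasurableI2[of customers])
  moreover have "buyers s Firm1 \<inter> buyers s Firm2 = {}"
    by (auto simp: buyers_def)
  ultimately have "measure lebesgue (buyers s Firm1 \<union> buyers s Firm2)
      = demand s Firm1 + demand s Firm2"
    by (simp add: demand_def measure_Un3)
  with split measure_customers show ?thesis by simp
qed

lemma fair_imp_some_full:
  assumes "feasible d V t s" "horizontally_fair d t s" "t > 0"
  shows "\<exists>i. xai s i = 1"
proof -
  have "demand s Firm1 > 0 \<or> demand s Firm2 > 0"
    using feasible_total_demand[OF assms(1)] by linarith
  with fair_demand_pos_imp_full[OF assms(2,3)] show ?thesis by blast
qed

text \<open>Quality costs are nonnegative, so a positive profit needs positive revenue.\<close>

lemma profit_pos_imp_demand_pos: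
  assumes "feasible d V t s" "profit \<beta> s i > 0" "\<beta> \<ge> 0"
  shows "demand s i > 0"
proof -
  have "0 \<le> \<beta> * (quality s i)\<^sup>2"
    using assms(3) by simp
  then have "price s i * demand s i > 0"
    using assms(2) unfolding profit_def by linarith
  moreover have "price s i \<ge> 0"
    using assms(1) by (simp add: feasible_def)
  ultimately show ?thesis
    by (simp add: zero_less_mult_iff)
qed

text \<open>The firm \<open>j\<close> contradicts fairness: its profit shows that it sells, yet its
  explanations are not full.\<close>

lemma ex_partial_explainer_with_profit:
  assumes "market_equilibrium d r 1 1 \<xi> m X P" "X i = 1"
  shows "\<exists>j. X j \<noteq> 1 \<and> P j > 0"
proof -
  have "possible d r 1 1 \<xi> m X P" and nonneg: "r = Mandatory \<Longrightarrow> P Firm1 \<ge> 0"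
    using assms(1) by (auto simp: market_equilibrium_def selected_def)
  then show ?thesis
  proof cases
    case E1_max
    \<comment> \<open>Firm 2 offers level 0, so \<open>i\<close> is firm 1. Then \<open>N2\<close> =
      11, \<open>D\<close> = 17 and \<open>M\<close> = 35.\<close>
    with assms(2) have "\<xi> = 1"
      by (cases i) auto
    with E1_max show ?thesis
      by (intro exI[of _ Firm2]) simp
  next
    case E1_min
    with assms(2) have "\<xi> = 1"
      by (cases i) auto
    with E1_min show ?thesis
      by (intro exI[of _ Firm2]) simp
  \<comment> \<open>Contradictory cases: Q2 would need 1 < 4/9, E2 gives firm 1 the profit -1/144,
    and E0 has both levels 0.\<close>
  qed (use assms(2) nonneg in \<open>cases i; simp\<close>)+
qed

lemma equilibrium_not_fair:
  assumes "equilibrium d r V 1 1 \<xi> s"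
  shows "\<not> horizontally_fair d 1 s"
proof
  assume fair: "horizontally_fair d 1 s"
  from assms obtain m P where feas: "feasible d V 1 s"
    and eq: "market_equilibrium d r 1 1 \<xi> m (xai s) P" and P: "\<And>i. profit 1 s i = P i"
    by (auto simp: equilibrium_def)
  obtain i where "xai s i = 1"
    using fair_imp_some_full[OF feas fair] by auto
  with eq obtain j where "xai s j \<noteq> 1" "P j > 0"
    using ex_partial_explainer_with_profit by blast
  moreover have "demand s j > 0"
    using profit_pos_imp_demand_pos[OF feas, of 1 j] \<open>P j > 0\<close> P by simp
  ultimately show False
    using fair_demand_pos_imp_full[OF fair] by simp
qed

theorem proposition8:
  shows "\<forall>d. \<exists>\<beta>>0. \<exists>t>0. \<forall>V. \<forall>\<xi>\<in>{0..1}.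
           \<not> (\<exists>s. equilibrium d Mandatory V \<beta> t \<xi> s \<and> horizontally_fair d t s) \<and>
           \<not> (\<exists>s. equilibrium d Optional V \<beta> t \<xi> s \<and> horizontally_fair d t s)"
  using equilibrium_not_fair zero_less_one by blast

end
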